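(* Let $(X,\langle\cdot\,|\,\cdot\rangle_{IP})$ be a real inner product space with the generated norm $\|\vec x\|=\sqrt{\langle\vec x\,|\,\vec x\rangle_{IP}}$, and let $\varrho$ be any real number. Then the triple $(X,\|\cdot\|,\langle\cdot\,|\,\cdot\rangle_\varrho)$ fulfils the Cauchy-Schwarz-Bunjakowsky inequality, i.e. $|\langle\vec x\,|\,\vec y\rangle_\varrho|\le\|\vec x\|\cdot\|\vec y\|$ for all $\vec x,\vec y\in X$, and for all $\vec x,\vec y\ne\vec 0$ one has $\angle_\varrho(\vec x,\vec y)=\angle_{Euclid}(\vec x,\vec y)$.
   Context: For $\vec x,\vec y\in X\setminus\{\vec 0\}$ put $\mathbf{s}=\left\|\frac{\vec x}{\|\vec x\|}+\frac{\vec y}{\|\vec y\|}\right\|$, $\mathbf{d}=\left\|\frac{\vec x}{\|\vec x\|}-\frac{\vec y}{\|\vec y\|}\right\|$, $\mathbf{\Sigma}=\mathbf{s}^2+\mathbf{d}^2$, $\mathbf{\Delta}=\mathbf{s}^2-\mathbf{d}^2$, and $\langle\vec x\,|\,\vec y\rangle_\varrho=\|\vec x\|\cdot\|\vec y\|\cdot\frac14\mathbf{\Delta}\cdot\left(\frac14\mathbf{\Sigma}\right)^{\varrho}$; put $\langle\vec x\,|\,\vec y\rangle_\varrho=0$ if $\vec x=\vec 0$ or $\vec y=\vec 0$. The $\varrho$-angle is $\angle_\varrho(\vec x,\vec y):=\arccos\frac{\langle\vec x|\vec y\rangle_\varrho}{\|\vec x\|\|\vec y\|}$, defined for $\vec x,\vec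 y\neq\vec 0$ with $|\langle\vec x\,|\,\vec y\rangle_\varrho|\le\|\vec x\|\cdot\|\vec y\|$. The Euclidean angle is $\angle_{Euclid}(\vec x,\vec y):=\arccos\frac{\langle\vec x|\vec y\rangle_{IP}}{\|\vec x\|\|\vec y\|}$. *)

theory Defs
  imports "HOL-Analysis.Inner_Product"
begin

definition s_val :: "'a::real_normed_vector \<Rightarrow> 'a \<Rightarrow> real" where
  "s_val x y = norm (x /\<^sub>R norm x + y /\<^sub>R norm y)"

definition d_val :: "'a::real_normed_vector \<Rightarrow> 'a \<Rightarrow> real" where
  "d_val x y = norm (x /\<^sub>R norm x - y /\<^sub>R norm y)"

definition Sigma_val :: "'a::real_normed_vector \<Rightarrow> 'a \<Rightarrow> real" where
  "Sigma_val x y = (s_val x y)\<^sup>2 + (d_val x y)\<^sup>2"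

definition Delta_val :: "'a::real_normed_vector \<Rightarrow> 'a \<Rightarrow> real" where
  "Delta_val x y = (s_val x y)\<^sup>2 - (d_val x y)\<^sup>2"

text \<open>For nonzero arguments the base of the real power below is positive: the sum of the two
  norms entering \<open>Sigma_val\<close> is at least 2 by the triangle inequality.\<close>

definition rho_product :: "real \<Rightarrow> 'a::real_normed_vector \<Rightarrow> 'a \<Rightarrow> real" where
  "rho_product \<rho> x y =
     (if x = 0 \<or> y = 0 then 0
      else norm x * norm y * (1/4 * Delta_val x y) * (1/4 * Sigma_val x y) powr \<rho>)"

text \<open>Both angles are meant for nonzero vectors only. The angle \<open>rho_angle\<close> is moreover only
  meaningful when \<open>\<bar>rho_product \<rho> x y\<bar> \<le> norm x * norm y\<close>; outside \<open>[-1, 1]\<close> the library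
  function \<open>arccos\<close> has an unspecified value.\<close>

definition rho_angle :: "real \<Rightarrow> 'a::real_normed_vector \<Rightarrow> 'a \<Rightarrow> real" where
  "rho_angle \<rho> x y = arccos (rho_product \<rho> x y / (norm x * norm y))"

definition euclid_angle :: "'a::real_inner \<Rightarrow> 'a \<Rightarrow> real" where
  "euclid_angle x y = arccos (inner x y / (norm x * norm y))"

end

theory Submission
  imports Defs
begin

text \<open>In an inner product space the family of products \<open>rho_product \<rho>\<close> collapses to a single one,
  the inner product itself. The parallelogram law, applied to the normalised vectors, gives
  \<open>\<Sigma> = 2 * (1 + 1) = 4\<close>, so the factor \<open>(\<Sigma> / 4) powr \<rho>\<close>, the only place where \<open>\<rho>\<close> enters, equals
  \<open>1\<close>. The polarisation identity for the same vectors turns \<open>\<Delta> / 4\<close> into their inner product,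
  and multiplying by both norms undoes the normalisation. The bound is then the
  Cauchy-Schwarz inequality, and the two angles are arc cosines of the same number.\<close>

lemma parallelogram_law:
  fixes u v :: "'a::real_inner"
  shows "(norm (u + v))\<^sup>2 + (norm (u - v))\<^sup>2 = 2 * ((norm u)\<^sup>2 + (norm v)\<^sup>2)"
  by (simp add: power2_norm_eq_inner algebra_simps inner_commute)

lemma polarisation_identity:
  fixes u v :: "'a::real_inner"
  shows "(norm (u + v))\<^sup>2 - (norm (u - v))\<^sup>2 = 4 * inner u v"
  by (simp add: power2_norm_eq_inner algebra_simps inner_commute)

lemma Sigma_val_inner:
  fixes x y :: "'a::real_inner"
  assumes "x \<noteq> 0" and "y \<noteq> 0"
  shows "Sigma_val x y = 4"
  using assms by (simp add: Sigma_val_def s_val_def d_val_def parallelogram_law)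

lemma Delta_val_inner:
  fixes x y :: "'a::real_inner"
  shows "Delta_val x y = 4 * (inner x y / (norm x * norm y))"
  by (simp add: Delta_val_def s_val_def d_val_def polarisation_identity divide_simps)

lemma rho_product_eq_inner:
  fixes x y :: "'a::real_inner"
  shows "rho_product \<rho> x y = inner x y"
  by (simp add: rho_product_def Sigma_val_inner Delta_val_inner)

theorem proposition1:
  fixes \<rho> :: real
  shows "(\<forall>x y :: 'a::real_inner. \<bar>rho_product \<rho> x y\<bar> \<le> norm x * norm y) \<and>
         (\<forall>x y :: 'a. x \<noteq> 0 \<longrightarrow> y \<noteq> 0 \<longrightarrow> rho_angle \<rho> x y = euclid_angle x y)"
  by (simp add: rho_product_eq_inner rho_angle_def euclid_angle_def Cauchy_Schwarz_ineq2)

end
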